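(* Let $n\ge 1$, let $W$ be any Dyck path of length $2n$, and let $S\subseteq[2n-1]$. Let $\beta_n$ denote the flag $h$-vector of the distributive lattice $J(\mathbf{2}\times\mathbf{n})$. Then $$\beta_n(S)=|\{w\in\mathcal{D}_n : D_W(w)=S\}|.$$
   Context: A Dyck path of length $2n$ is a lattice path in $\mathbb{N}\times\mathbb{N}$ from $(0,0)$ to $(n,n)$ with steps $v=(0,1)$ and $h=(1,0)$ never going below the line $x=y$; $\mathcal{D}_n$ is the set of these, written as words in $v,h$. A Dyck path is coded in letters $v_1,v_2,\dots,h_1,h_2,\dots$ by letting $v_i$ (resp. $h_i$) denote the $i$-th vertical (resp. horizontal) step; e.g. $vvhvhh$ is coded $v_1v_2h_1v_3h_2h_3$. For Dyck paths $W$ and $w=w_1w_2\cdots w_{2n}$ (coded this way), the descent set of $w$ with respect to $W$ is $D_W(w)=\{i\in[2n-1]: w_{i+1}\text{ occurs before } w_i \text{ in } W\}$. $\mathbf{2}\times\mathbf{n}$ is the product of chains $\{1<2\}\times\{1<\dots<n\}$ with componentwise order, and $J(\mathbf{2}\times\mathbf{n})$ is the lattice of its order ideals ordered by inclusion, graded of rank $2n$ by cardinality. For a finite graded poset $P$ with $\hat 0,\hat 1$, rank function $\rho$ and $\rho(\hat 1)=N$, the flag $f$-vector is $\alpha_P(S)=|\{c \text{ a chain of } P: \rho(c)=S\}|$ for $S\subseteq[N-1]$ (where $\rho(c)$ is the set of ranks of elements of $c$), and the flag $h$-vector is $\beta_P(S)=\sum_{T\subseteq S}(-1)^{|S-T|}\alpha_P(T)$.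 *)

theory Defs
  imports Main "HOL-Library.Product_Plus" "HOL-Library.Product_Order"
begin

datatype step = V | H

fun step_vector :: "step \<Rightarrow> nat \<times> nat" where
  "step_vector V = (0, 1)"
| "step_vector H = (1, 0)"

definition endpoint :: "step list \<Rightarrow> nat \<times> nat" where
  "endpoint w = (\<Sum>s\<leftarrow>w. step_vector s)"

definition dyck_paths :: "nat \<Rightarrow> step list set" where
  "dyck_paths n = {w. length w = 2 * n \<and> endpoint w = (n, n) \<and>
     (\<forall>k\<le>length w. fst (endpoint (take k w)) \<le> snd (endpoint (take k w)))}"

text \<open>The letter \<open>v\<^sub>i\<close> is encoded as \<open>(V, i)\<close> and \<open>h\<^sub>i\<close> as \<open>(H, i)\<close>, with \<open>i\<close> starting at 1.
  List positions start at 0.\<close>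

definition letter :: "step list \<Rightarrow> nat \<Rightarrow> step \<times> nat" where
  "letter w k = (w ! k, count_list (take (Suc k) w) (w ! k))"

definition coded :: "step list \<Rightarrow> (step \<times> nat) list" where
  "coded w = map (letter w) [0..<length w]"

definition occurs_before :: "'a list \<Rightarrow> 'a \<Rightarrow> 'a \<Rightarrow> bool" where
  "occurs_before xs a b \<longleftrightarrow> (\<exists>p q. p < q \<and> q < length xs \<and> xs ! p = a \<and> xs ! q = b)"

text \<open>Descents are numbered from 1: \<open>w\<^sub>i\<close> is \<open>coded w ! (i - 1)\<close> and \<open>w\<^sub>i\<^sub>+\<^sub>1\<close> is \<open>coded w ! i\<close>.\<close>

definition descent_set :: "step list \<Rightarrow> step list \<Rightarrow> nat set" where
  "descent_set W w =
     {i \<in> {1..length w - 1}. occurs_before (coded W) (coded w ! i) (coded w ! (i - 1))}"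

text \<open>The order on \<open>nat \<times> nat\<close> is the componentwise one of \<open>Product_Order\<close>.\<close>

definition two_times :: "nat \<Rightarrow> (nat \<times> nat) set" where
  "two_times n = {1..2} \<times> {1..n}"

definition order_ideals :: "'a::order set \<Rightarrow> 'a set set" where
  "order_ideals P = {I. I \<subseteq> P \<and> (\<forall>x\<in>I. \<forall>y\<in>P. y \<le> x \<longrightarrow> y \<in> I)}"

definition flag_f :: "'a::order set \<Rightarrow> ('a \<Rightarrow> nat) \<Rightarrow> nat set \<Rightarrow> nat" where
  "flag_f P \<rho> S = card {c. c \<subseteq> P \<and> Complete_Partial_Order.chain (\<le>) c \<and> \<rho> ` c = S}"

definition flag_h :: "'a::order set \<Rightarrow> ('a \<Rightarrow> nat) \<Rightarrow> nat set \<Rightarrow> int" where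
  "flag_h P \<rho> S = (\<Sum>T\<in>Pow S. (- 1) ^ card (S - T) * int (flag_f P \<rho> T))"

text \<open>Sets are ordered by inclusion, and the rank function of the lattice of order ideals
  is cardinality.\<close>

definition flag_h_J2n :: "nat \<Rightarrow> nat set \<Rightarrow> int" where
  "flag_h_J2n n = flag_h (order_ideals (two_times n)) card"

end

theory Submission
  imports Defs
begin

text \<open>A Dyck path of length \<open>2n\<close> is a linear extension of \<open>{1, 2} \<times> {1..n}\<close>, and
  \<open>W\<close> plays the role of a natural labelling, so the statement is an instance of Stanley's theorem on the flag
  \<open>h\<close>-vector of \<open>J(P)\<close>. By Moebius inversion one has to show that the chains of \<open>J(P)\<close> with
  rank set \<open>T\<close> are equinumerous with the linear extensions \<open>w\<close> whose descents lie in \<open>T\<close>.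
  From \<open>w\<close> take the chain of its prefixes with length in \<open>T\<close>. From a chain recover \<open>w\<close>
  by sorting \<open>P\<close>, first by the number of members of the chain that miss an element, then by
  label.\<close>

section \<open>Linear extensions, descents and chains of ideals\<close>

text \<open>Compatibility with the order is phrased through prefixes, so that the prefixes of a word
  are directly elements of \<open>J(P)\<close>.\<close>

definition linear_extensions :: "'a::order set \<Rightarrow> 'a list set" where
  "linear_extensions P =
     {w. distinct w \<and> set w = P \<and> (\<forall>k\<le>length w. set (take k w) \<in> order_ideals P)}"

definition descents :: "'a list \<Rightarrow> 'a list \<Rightarrow> nat set" where
  "descents L w = {i \<in> {1..length w - 1}. occurs_before L (w ! i) (w ! (i - 1))}"

definition chains_of_rank :: "'a::order set \<Rightarrow> nat set \<Rightarrow> 'a set set set" where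
  "chains_of_rank P T =
     {c. c \<subseteq> order_ideals P \<and> Complete_Partial_Order.chain (\<le>) c \<and> card ` c = T}"

definition prefixes_of_length :: "nat set \<Rightarrow> 'a list \<Rightarrow> 'a set set" where
  "prefixes_of_length T w = (\<lambda>k. set (take k w)) ` T"

lemma nth_in_set_take_iff:
  assumes "distinct w" "i < length w"
  shows "w ! i \<in> set (take k w) \<longleftrightarrow> i < k"
  using assms by (auto simp: in_set_conv_nth nth_eq_iff_index_eq)

text \<open>An element outside the prefix lies in the remaining suffix, where every key exceeds all
  keys of the prefix.\<close>

lemma sorted_prefix_downward:
  fixes key :: "'a \<Rightarrow> nat"
  assumes "sorted_wrt (\<lambda>x y. key x < key y) w"
    and "y \<in> set (take k w)" "x \<in> set w" "key x \<le> key y"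
  shows "x \<in> set (take k w)"
proof (rule ccontr)
  assume "x \<notin> set (take k w)"
  moreover have "set w = set (take k w) \<union> set (drop k w)"
    by (metis append_take_drop_id set_append)
  ultimately have "x \<in> set (drop k w)" using assms(3) by blast
  moreover have "sorted_wrt (\<lambda>x y. key x < key y) (take k w @ drop k w)"
    using assms(1) by simp
  ultimately have "key y < key x" using assms(2) unfolding sorted_wrt_append by blast
  then show False using assms(4) by simp
qed

text \<open>Both lists of keys are strictly increasing with the same set, hence equal, and
  injectivity carries this back to the words.\<close>

lemma sorted_by_key_unique:
  fixes key :: "'a \<Rightarrow> nat"
  assumes "sorted_wrt (\<lambda>x y. key x < key y) v" "sorted_wrt (\<lambda>x y. key x < key y) w"
    and "set v = set w" "inj_on key (set w)"
  shows "v = w"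
proof -
  have "sorted_wrt (<) (map key v)" "sorted_wrt (<) (map key w)"
    using assms by (simp_all add: sorted_wrt_map)
  then have "map key v = map key w"
    by (metis strict_sorted_equal assms(3) set_map)
  then show ?thesis using assms by (simp add: inj_on_map_eq_map)
qed

lemma chain_members_nested:
  assumes "Complete_Partial_Order.chain (\<le>) c" "I \<in> c" "J \<in> c"
    and "x \<in> I" "x \<notin> J"
  shows "J \<subseteq> I"
  using assms unfolding Complete_Partial_Order.chain_def by blast

section \<open>Labels given by positions in a fixed linear extension\<close>

locale natural_labelling =
  fixes P :: "'a::order set" and L :: "'a list"
  assumes L: "L \<in> linear_extensions P"
begin

lemma distinct_L: "distinct L" and set_L: "set L = P"
  and L_prefix: "k \<le> length L \<Longrightarrow> set (take k L) \<in> order_ideals P"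
  using L by (auto simp: linear_extensions_def)

lemma finite_P: "finite P"
  using set_L by auto

lemma length_L: "length L = card P"
  using distinct_card[OF distinct_L] set_L by simp

definition pos :: "'a \<Rightarrow> nat" where
  "pos = inv_into {..<length L} ((!) L)"

lemma pos_nth: "p < length L \<Longrightarrow> pos (L ! p) = p"
  unfolding pos_def using distinct_L by (intro inv_into_f_f inj_on_nth) auto

lemma pos_less: "x \<in> P \<Longrightarrow> pos x < card P"
  using pos_nth set_L length_L by (auto simp: in_set_conv_nth)

lemma nth_pos: "x \<in> P \<Longrightarrow> L ! pos x = x"
  using pos_nth set_L by (auto simp: in_set_conv_nth)

lemma occurs_before_iff:
  assumes "x \<in> P" "y \<in> P"
  shows "occurs_before L x y \<longleftrightarrow> pos x < pos y"
proof
  show "pos x < pos y" if "occurs_before L x y"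
    using that pos_nth by (auto simp: occurs_before_def)
  show "occurs_before L x y" if "pos x < pos y"
    unfolding occurs_before_def
    using that assms nth_pos pos_less length_L by (intro exI[of _ "pos x"] exI[of _ "pos y"]) simp
qed

text \<open>The prefix of \<open>L\<close> ending at \<open>y\<close> is an order ideal, so it
  contains \<open>x\<close>. This is the naturality of the labelling.\<close>

lemma pos_mono:
  assumes "x \<in> P" "y \<in> P" "x \<le> y"
  shows "pos x \<le> pos y"
proof -
  let ?I = "set (take (Suc (pos y)) L)"
  have *: "z \<in> ?I \<longleftrightarrow> pos z < Suc (pos y)" if "z \<in> P" for z
    using nth_in_set_take_iff[OF distinct_L, of "pos z" "Suc (pos y)"]
      nth_pos[OF that] pos_less[OF that] length_L by simp
  have "?I \<in> order_ideals P"
    using L_prefix pos_less[OF assms(2)] length_L by simp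
  then have "x \<in> ?I"
    using assms * by (auto simp: order_ideals_def)
  then show ?thesis using * assms(1) by simp
qed

section \<open>From chains to words\<close>

text \<open>A finite chain of ideals cuts \<open>P\<close> into successive differences of its
  members; the level is the index of the block containing \<open>x\<close>, starting at 0.\<close>

definition level :: "'a set set \<Rightarrow> 'a \<Rightarrow> nat" where
  "level c x = card {I \<in> c. x \<notin> I}"

text \<open>As labels are below \<^term>\<open>card P\<close>, this encodes the lexicographic order on pairs of
  level and label.\<close>

definition key :: "'a set set \<Rightarrow> 'a \<Rightarrow> nat" where
  "key c x = level c x * card P + pos x"

definition word_of_chain :: "'a set set \<Rightarrow> 'a list" where
  "word_of_chain c = sort_key (key c) L"

lemma key_less_iff:
  assumes "x \<in> P" "y \<in> P"
  shows "key c x < key c y \<longleftrightarrow>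
    level c x < level c y \<or> level c x = level c y \<and> pos x < pos y"
proof -
  \<comment> \<open>Comparison in base \<open>N\<close>: since the lower digit \<open>p\<close> is
    below \<open>N\<close>, a strictly smaller upper digit decides.\<close>
  have "a * N + p < b * N + q" if "a < b" "p < N" for a b N p q :: nat
  proof -
    have "a * N + p < Suc a * N" using that by simp
    also have "\<dots> \<le> b * N" using that by (intro mult_right_mono) auto
    finally show ?thesis by simp
  qed
  from this[of "level c x" "level c y" "pos x" "card P" "pos y"]
    this[of "level c y" "level c x" "pos y" "card P" "pos x"]
  show ?thesis
    using pos_less[OF assms(1)] pos_less[OF assms(2)] unfolding key_def
    by (cases "level c x" "level c y" rule: linorder_cases) auto
qed

lemma inj_on_key: "inj_on (key c) P"
proof (rule inj_onI)
  fix x y assume xy: "x \<in> P" "y \<in> P" and "key c x = key c y"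
  then have "pos x = pos y"
    using key_less_iff[OF xy, of c] key_less_iff[OF xy(2,1), of c] by auto
  then show "x = y" using nth_pos xy by metis
qed

lemma word_of_chain_sorted: "sorted_wrt (\<lambda>x y. key c x < key c y) (word_of_chain c)"
proof -
  have "distinct (map (key c) (word_of_chain c))"
    using inj_on_key distinct_L set_L by (simp add: word_of_chain_def distinct_map)
  then have "sorted_wrt (<) (map (key c) (word_of_chain c))"
    unfolding strict_sorted_iff by (simp add: word_of_chain_def)
  then show ?thesis by (simp add: sorted_wrt_map)
qed

lemma set_word_of_chain: "set (word_of_chain c) = P"
  and distinct_word_of_chain: "distinct (word_of_chain c)"
  and length_word_of_chain: "length (word_of_chain c) = card P"
  by (simp_all add: word_of_chain_def set_L distinct_L length_L)

context
  fixes T :: "nat set"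
  assumes T: "T \<subseteq> {..card P}"
begin

context
  fixes c assumes c: "c \<in> chains_of_rank P T"
begin

lemma chain_c: "Complete_Partial_Order.chain (\<le>) c"
  and ideal_c: "I \<in> c \<Longrightarrow> I \<in> order_ideals P"
  and card_c: "card ` c = T"
  using c by (auto simp: chains_of_rank_def)

lemma finite_c: "finite c"
proof -
  have "c \<subseteq> Pow P" using ideal_c by (auto simp: order_ideals_def)
  then show ?thesis using finite_P finite_subset by blast
qed

text \<open>Every member of the chain missing \<open>x\<close> is contained in \<open>I\<close> and
  so misses \<open>y\<close>; moreover \<open>I\<close> itself is counted only for
  \<open>y\<close>.\<close>

lemma level_less:
  assumes "I \<in> c" "x \<in> I" "y \<notin> I"
  shows "level c x < level c y"
  unfolding level_def
proof (rule psubset_card_mono)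
  show "{J \<in> c. x \<notin> J} \<subset> {J \<in> c. y \<notin> J}"
    using chain_members_nested[OF chain_c] assms by blast
qed (simp add: finite_c)

text \<open>An ideal that misses \<open>x\<close> misses everything above \<open>x\<close>.\<close>

lemma level_mono:
  assumes "x \<in> P" "x \<le> y"
  shows "level c x \<le> level c y"
  unfolding level_def
proof (rule card_mono)
  show "{J \<in> c. x \<notin> J} \<subseteq> {J \<in> c. y \<notin> J}"
    using assms ideal_c by (auto simp: order_ideals_def)
qed (simp add: finite_c)

lemma key_mono:
  assumes "x \<in> P" "y \<in> P" "x \<le> y"
  shows "key c x \<le> key c y"
  using pos_mono[OF assms] level_mono[OF assms(1,3)] by (simp add: key_def add_mono)

text \<open>All elements of \<open>I\<close> have smaller keys than the elements outside, so the
  sorted word lists \<open>I\<close> first.\<close>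

lemma member_eq_prefix:
  assumes "I \<in> c"
  shows "I = set (take (card I) (word_of_chain c))"
proof -
  let ?w = "word_of_chain c"
  let ?Q = "set (take (card I) ?w)"
  have IP: "I \<subseteq> P" using ideal_c[OF assms] by (auto simp: order_ideals_def)
  then have "card I \<le> card P" using finite_P by (simp add: card_mono)
  then have card: "card ?Q = card I"
    using distinct_card[OF distinct_take[OF distinct_word_of_chain, of "card I" c]]
    by (simp add: length_word_of_chain)
  have "I \<subseteq> ?Q"
  proof
    fix x assume x: "x \<in> I"
    show "x \<in> ?Q"
    \<comment> \<open>If the prefix lies inside \<open>I\<close>, equal cardinalities force
      equality. Otherwise it has an element outside \<open>I\<close>, whose larger key pulls
      \<open>x\<close> into the prefix.\<close>
    proof (cases "?Q \<subseteq> I")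
      case True
      then show ?thesis
        using card x card_subset_eq finite_subset[OF IP finite_P] by metis
    next
      case False
      then obtain y where y: "y \<in> ?Q" "y \<notin> I" by blast
      have "y \<in> P" using y(1) set_word_of_chain in_set_takeD by metis
      then have "key c x < key c y"
        using level_less[OF assms x y(2)] x IP key_less_iff by blast
      then show ?thesis
        using sorted_prefix_downward[OF word_of_chain_sorted y(1)] x IP
        by (simp add: set_word_of_chain subsetD)
    qed
  qed
  then show ?thesis using card by (simp add: card_subset_eq)
qed

lemma prefixes_word_of_chain: "prefixes_of_length T (word_of_chain c) = c"
proof -
  have "prefixes_of_length T (word_of_chain c) =
      (\<lambda>I. set (take (card I) (word_of_chain c))) ` c"
    unfolding prefixes_of_length_def card_c[symmetric] by (simp add: image_image)
  also have "\<dots> = c" using member_eq_prefix by simp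
  finally show ?thesis .
qed

text \<open>Keys increase weakly along the order of \<open>P\<close>, and prefixes of the sorted
  word are closed under passing to smaller keys.\<close>

lemma word_of_chain_in_linear_extensions: "word_of_chain c \<in> linear_extensions P"
proof -
  have "set (take k (word_of_chain c)) \<in> order_ideals P" for k
    unfolding order_ideals_def
  proof (intro CollectI conjI ballI impI)
    show sub: "set (take k (word_of_chain c)) \<subseteq> P"
      using set_word_of_chain set_take_subset by metis
    fix x y assume "x \<in> set (take k (word_of_chain c))" "y \<in> P" "y \<le> x"
    then show "y \<in> set (take k (word_of_chain c))"
      using sorted_prefix_downward[OF word_of_chain_sorted] key_mono sub
      by (metis set_word_of_chain subsetD)
  qed
  then show ?thesis
    by (simp add: linear_extensions_def set_word_of_chain distinct_word_of_chain)
qed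

text \<open>At a descent the label drops while the key rises, so the level must rise. Hence some
  member of the chain separates the two neighbours, and it is the prefix ending between
  them.\<close>

lemma descents_word_of_chain: "descents L (word_of_chain c) \<subseteq> T"
proof
  let ?w = "word_of_chain c"
  fix i assume "i \<in> descents L ?w"
  then have i: "1 \<le> i" "i < card P" and occ: "occurs_before L (?w ! i) (?w ! (i - 1))"
    by (auto simp: descents_def length_word_of_chain)
  have inP: "?w ! j \<in> P" if "j < card P" for j
    using that set_word_of_chain length_word_of_chain nth_mem by metis
  have P: "?w ! i \<in> P" "?w ! (i - 1) \<in> P" using i by (auto intro: inP)
  have "pos (?w ! i) < pos (?w ! (i - 1))"
    using occ occurs_before_iff P by simp
  moreover have "key c (?w ! (i - 1)) < key c (?w ! i)"
    using sorted_wrt_nth_less[OF word_of_chain_sorted, of "i - 1" i c] i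
    by (simp add: length_word_of_chain)
  ultimately have "level c (?w ! (i - 1)) < level c (?w ! i)"
    using key_less_iff P by auto
  moreover have "level c (?w ! i) \<le> level c (?w ! (i - 1))"
    if "{I \<in> c. ?w ! i \<notin> I} \<subseteq> {I \<in> c. ?w ! (i - 1) \<notin> I}"
    unfolding level_def using that finite_c by (intro card_mono) simp_all
  ultimately have "\<not> {I \<in> c. ?w ! i \<notin> I} \<subseteq> {I \<in> c. ?w ! (i - 1) \<notin> I}"
    by linarith
  then obtain I where I: "I \<in> c" "?w ! (i - 1) \<in> I" "?w ! i \<notin> I" by blast
  \<comment> \<open>List positions start at 0, so containing entry \<open>i - 1\<close> but not
    entry \<open>i\<close> means that the prefix has length exactly \<open>i\<close>.\<close>
  have "i - 1 < card I" "\<not> i < card I"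
    using I member_eq_prefix[OF I(1)] i
      nth_in_set_take_iff[OF distinct_word_of_chain, of "i - 1" c "card I"]
      nth_in_set_take_iff[OF distinct_word_of_chain, of i c "card I"]
    by (auto simp: length_word_of_chain)
  then have "card I = i" by simp
  then show "i \<in> T" using card_c I(1) by blast
qed

end

section \<open>From words back to chains\<close>

context
  fixes w assumes w: "w \<in> linear_extensions P" and desc: "descents L w \<subseteq> T"
begin

lemma distinct_w: "distinct w" and set_w: "set w = P"
  and w_prefix: "k \<le> length w \<Longrightarrow> set (take k w) \<in> order_ideals P"
  using w by (auto simp: linear_extensions_def)

lemma length_w: "length w = card P"
  using distinct_card[OF distinct_w] set_w by simp

lemma prefixes_in_chains: "prefixes_of_length T w \<in> chains_of_rank P T"
proof -
  \<comment> \<open>The bound on \<open>T\<close> ensures that \<open>take k w\<close> really has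
    \<open>k\<close> entries.\<close>
  have "card (set (take k w)) = k" if "k \<in> T" for k
    using distinct_card[OF distinct_take[OF distinct_w, of k]] that T length_w by auto
  then have "card ` prefixes_of_length T w = T"
    by (simp add: prefixes_of_length_def image_image)
  moreover have "prefixes_of_length T w \<subseteq> order_ideals P"
    using w_prefix T length_w by (auto simp: prefixes_of_length_def)
  moreover have "Complete_Partial_Order.chain (\<le>) (prefixes_of_length T w)"
  proof (rule chainI)
    fix I J assume "I \<in> prefixes_of_length T w" "J \<in> prefixes_of_length T w"
    then obtain k l where "I = set (take k w)" "J = set (take l w)"
      by (auto simp: prefixes_of_length_def)
    then show "I \<le> J \<or> J \<le> I"
      using set_take_subset_set_take[of k l w] set_take_subset_set_take[of l k w]
      by (cases "k \<le> l") simp_all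
  qed
  ultimately show ?thesis by (simp add: chains_of_rank_def)
qed

text \<open>It suffices to compare neighbours. At a length in \<open>T\<close> the prefix of that
  length separates them and the level rises; at any other length there is no descent, so the label
  rises while the level does not fall.\<close>

lemma sorted_by_prefixes:
  "sorted_wrt (\<lambda>x y. key (prefixes_of_length T w) x < key (prefixes_of_length T w) y) w"
  (is "sorted_wrt ?R w")
proof -
  let ?c = "prefixes_of_length T w"
  have "key ?c (w ! i) < key ?c (w ! Suc i)" if i: "Suc i < length w" for i
  proof -
    have i': "Suc i \<in> {1..length w - 1}" using i by simp
    have P: "w ! i \<in> P" "w ! Suc i \<in> P" using i set_w by (auto dest: nth_mem)
    have mem: "w ! j \<in> set (take k w) \<longleftrightarrow> j < k" if "j \<le> Suc i" for j k
      using nth_in_set_take_iff[OF distinct_w] i that by simp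
    have "finite ?c"
      using finite_subset[OF T] by (simp add: prefixes_of_length_def)
    \<comment> \<open>A prefix that misses an entry also misses the next one.\<close>
    then have le: "level ?c (w ! i) \<le> level ?c (w ! Suc i)"
      unfolding level_def by (intro card_mono) (auto simp: prefixes_of_length_def mem)
    show ?thesis
    proof (cases "Suc i \<in> T")
      case True
      then have "set (take (Suc i) w) \<in> ?c" by (auto simp: prefixes_of_length_def)
      then have "level ?c (w ! i) < level ?c (w ! Suc i)"
        using level_less[OF prefixes_in_chains] mem by auto
      then show ?thesis using key_less_iff P by simp
    next
      case False
      then have "\<not> occurs_before L (w ! Suc i) (w ! i)"
        using subsetD[OF desc, of "Suc i"] i' by (auto simp: descents_def)
      then have "pos (w ! i) \<le> pos (w ! Suc i)"
        using occurs_before_iff P by simp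
      moreover have "w ! i \<noteq> w ! Suc i"
        using distinct_w i by (simp add: nth_eq_iff_index_eq)
      then have "pos (w ! i) \<noteq> pos (w ! Suc i)" using nth_pos P by metis
      ultimately show ?thesis using le key_less_iff P by auto
    qed
  qed
  then show ?thesis
    by (subst sorted_wrt_iff_nth_Suc_transp) (auto intro: transpI)
qed

text \<open>Both words are strictly sorted by the same injective key.\<close>

lemma word_of_prefixes: "word_of_chain (prefixes_of_length T w) = w"
  by (rule sorted_by_key_unique[OF word_of_chain_sorted sorted_by_prefixes])
    (simp_all add: set_word_of_chain set_w inj_on_key)

end

text \<open>\<open>word_of_chain\<close> and \<open>prefixes_of_length T\<close> are mutually
  inverse between the two sets.\<close>

lemma card_chains_of_rank:
  "card (chains_of_rank P T) = card {w \<in> linear_extensions P. descents L w \<subseteq> T}"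
proof -
  have "bij_betw word_of_chain (chains_of_rank P T) {w \<in> linear_extensions P. descents L w \<subseteq> T}"
  proof (rule bij_betw_byWitness[where f' = "prefixes_of_length T"])
    show "word_of_chain ` chains_of_rank P T \<subseteq> {w \<in> linear_extensions P. descents L w \<subseteq> T}"
      using word_of_chain_in_linear_extensions descents_word_of_chain by blast
    show "prefixes_of_length T ` {w \<in> linear_extensions P. descents L w \<subseteq> T} \<subseteq> chains_of_rank P T"
      using prefixes_in_chains by blast
  qed (simp_all add: prefixes_word_of_chain word_of_prefixes)
  then show ?thesis by (rule bij_betw_same_card)
qed

end

section \<open>Moebius inversion over subsets of ranks\<close>

lemma finite_linear_extensions: "finite (linear_extensions P)"
proof (rule finite_subset)
  show "linear_extensions P \<subseteq> {w. set w \<subseteq> P \<and> length w \<le> card P}"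
  proof
    fix w assume "w \<in> linear_extensions P"
    then have "distinct w" "set w = P" by (simp_all add: linear_extensions_def)
    then show "w \<in> {w. set w \<subseteq> P \<and> length w \<le> card P}"
      using distinct_card[of w] by simp
  qed
qed (simp add: finite_P finite_lists_length_le)

text \<open>Counting words with descents inside \<open>U\<close> sums the exact counts over all
  subsets of \<open>U\<close>. Inverting this, and replacing the cumulative counts by
  \<open>flag_f\<close>, gives the defining sum of \<open>flag_h\<close>.\<close>

theorem flag_h_order_ideals:
  assumes "S \<subseteq> {..card P}"
  shows "flag_h (order_ideals P) card S = int (card {w \<in> linear_extensions P. descents L w = S})"
proof -
  let ?f = "\<lambda>U. int (card {w \<in> linear_extensions P. descents L w = U})"
  let ?g = "\<lambda>U. int (card {w \<in> linear_extensions P. descents L w \<subseteq> U})"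
  have "?g U = sum ?f (Pow U)" if "finite U" for U
  proof -
    have *: "{w \<in> linear_extensions P. descents L w \<subseteq> U} =
        (\<Union>V\<in>Pow U. {w \<in> linear_extensions P. descents L w = V})"
      by blast
    then show ?thesis
      unfolding * using that finite_linear_extensions by (subst card_UN_disjoint) auto
  qed
  moreover have fin: "finite S" using assms finite_subset by blast
  ultimately have "?f S = (\<Sum>T\<in>Pow S. (-1) ^ (card S - card T) * ?g T)"
    by (rule inclusion_exclusion_mobius)
  also have "\<dots> = flag_h (order_ideals P) card S"
    unfolding flag_h_def
  proof (rule sum.cong[OF refl])
    fix T assume T: "T \<in> Pow S"
    then have "card (S - T) = card S - card T"
      using fin by (simp add: card_Diff_subset finite_subset)
    moreover have "flag_f (order_ideals P) card T = card {w \<in> linear_extensions P. descents L w \<subseteq> T}"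
      using card_chains_of_rank[of T] T assms by (auto simp: flag_f_def chains_of_rank_def)
    ultimately show "(-1) ^ (card S - card T) * ?g T =
        (-1) ^ card (S - T) * int (flag_f (order_ideals P) card T)" by simp
  qed
  finally show ?thesis ..
qed

end

section \<open>Dyck paths as linear extensions of the product of two chains\<close>

text \<open>With this choice \<open>(1, i) \<le> (2, i)\<close> expresses that the
  \<open>i\<close>-th horizontal step comes after the \<open>i\<close>-th vertical one, which is the
  Dyck condition.\<close>

fun poset_element :: "step \<times> nat \<Rightarrow> nat \<times> nat" where
  "poset_element (V, i) = (1, i)"
| "poset_element (H, i) = (2, i)"

definition element_word :: "step list \<Rightarrow> (nat \<times> nat) list" where
  "element_word w = map poset_element (coded w)"

text \<open>These are the elements used by a word with \<open>a\<close> vertical and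
  \<open>b\<close> horizontal steps.\<close>

definition two_columns :: "nat \<Rightarrow> nat \<Rightarrow> (nat \<times> nat) set" where
  "two_columns a b = {1} \<times> {1..a} \<union> {2} \<times> {1..b}"

lemma inj_poset_element: "inj poset_element"
proof (rule injI)
  fix x y assume "poset_element x = poset_element y"
  then show "x = y"
    by (cases x rule: poset_element.cases; cases y rule: poset_element.cases) auto
qed

text \<open>The code of an entry depends only on the prefix ending there, so appending a step leaves
  the earlier codes unchanged. This supports induction from the right.\<close>

lemma coded_snoc: "coded (w @ [s]) = coded w @ [(s, Suc (count_list w s))]"
  by (auto simp: coded_def letter_def nth_append)

lemma length_coded [simp]: "length (coded w) = length w"
  by (simp add: coded_def)

lemma map_fst_coded: "map fst (coded w) = w"
  by (induction w rule: rev_induct) (simp_all add: coded_snoc, simp add: coded_def)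

lemma length_element_word [simp]: "length (element_word w) = length w"
  by (simp add: element_word_def)

lemma element_word_Nil [simp]: "element_word [] = []"
  by (simp add: element_word_def coded_def)

lemma element_word_snoc:
  "element_word (w @ [s]) = element_word w @ [poset_element (s, Suc (count_list w s))]"
  by (simp add: element_word_def coded_snoc)

lemma inj_element_word: "inj element_word"
proof (rule injI)
  fix v w assume "element_word v = element_word w"
  then have "coded v = coded w"
    using inj_poset_element by (simp add: element_word_def inj_map_eq_map)
  then show "v = w" using map_fst_coded by metis
qed

lemma take_element_word: "take k (element_word w) = element_word (take k w)"
proof (induction w rule: rev_induct)
  case (snoc s w)
  then show ?case
    by (cases "k \<le> length w") (simp_all add: element_word_snoc)
qed simp

lemma set_element_word: "set (element_word w) = two_columns (count_list w V) (count_list w H)"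
proof (induction w rule: rev_induct)
  case (snoc s w)
  then show ?case
    by (cases s) (auto simp: element_word_snoc two_columns_def atLeastAtMostSuc_conv)
qed (simp add: two_columns_def)

lemma distinct_element_word: "distinct (element_word w)"
proof (induction w rule: rev_induct)
  case (snoc s w)
  then show ?case
    by (cases s) (auto simp: element_word_snoc set_element_word two_columns_def)
qed simp

lemma endpoint_eq_counts: "endpoint w = (count_list w H, count_list w V)"
  unfolding endpoint_def
proof (induction w)
  case (Cons s w)
  then show ?case by (cases s) auto
qed (simp add: zero_prod_def)

lemma length_eq_counts: "length w = count_list w V + count_list w H"
proof (induction w)
  case (Cons s w)
  then show ?case by (cases s) auto
qed simp

lemma two_columns_eq_iff: "two_columns a b = two_columns c d \<longleftrightarrow> a = c \<and> b = d"
proof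
  assume eq: "two_columns a b = two_columns c d"
  have "{1..a} = {1..c}" "{1..b} = {1..d}"
    using arg_cong[OF eq, of "\<lambda>A. {i. (1, i) \<in> A}"] arg_cong[OF eq, of "\<lambda>A. {i. (2, i) \<in> A}"]
    by (simp_all add: two_columns_def atLeastAtMost_def atLeast_def atMost_def Int_def)
  then show "a = c \<and> b = d" by (auto dest: arg_cong[where f = card])
qed simp

lemma two_times_eq: "two_times n = two_columns n n"
  by (auto simp: two_times_def two_columns_def)

text \<open>For positive \<open>b\<close> the element \<open>(2, b)\<close> lies above
  \<open>(1, b)\<close>, which forces \<open>b \<le> a\<close>.\<close>

lemma two_columns_in_order_ideals:
  "two_columns a b \<in> order_ideals (two_times n) \<longleftrightarrow> b \<le> a \<and> a \<le> n"
proof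
  assume I: "two_columns a b \<in> order_ideals (two_times n)"
  then have sub: "two_columns a b \<subseteq> two_times n"
    and down: "\<And>x y. x \<in> two_columns a b \<Longrightarrow> y \<in> two_times n \<Longrightarrow> y \<le> x \<Longrightarrow> y \<in> two_columns a b"
    by (auto simp: order_ideals_def)
  have "a \<le> n"
    using subsetD[OF sub, of "(1, a)"] by (cases "a = 0") (auto simp: two_columns_def two_times_def)
  moreover have "b \<le> a"
    using subsetD[OF sub, of "(2, b)"] down[of "(2, b)" "(1, b)"]
    by (cases "b = 0") (auto simp: two_columns_def two_times_def)
  ultimately show "b \<le> a \<and> a \<le> n" by simp
qed (auto simp: order_ideals_def two_columns_def two_times_def)

text \<open>By the count of steps in each prefix, being an ideal means not going below the diagonal;
  the bound by \<open>n\<close> follows from the total number of vertical steps.\<close>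

lemma element_word_linear_extension_iff:
  "element_word w \<in> linear_extensions (two_times n) \<longleftrightarrow> w \<in> dyck_paths n"
proof -
  have le: "count_list (take k w) V \<le> count_list w V" for k
    by (metis append_take_drop_id count_list_append le_add1)
  have "set (element_word w) = two_times n \<longleftrightarrow> count_list w V = n \<and> count_list w H = n"
    by (simp add: set_element_word two_times_eq two_columns_eq_iff)
  moreover have "set (take k (element_word w)) \<in> order_ideals (two_times n) \<longleftrightarrow>
      count_list (take k w) H \<le> count_list (take k w) V" if "count_list w V = n" for k
    using le[of k] that
    by (simp add: take_element_word set_element_word two_columns_in_order_ideals)
  ultimately show ?thesis
    unfolding linear_extensions_def dyck_paths_def
    by (auto simp: distinct_element_word endpoint_eq_counts length_eq_counts[of w])
qed

text \<open>Induction from the right: the elements so far fill \<open>two_columns\<close> of the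
  step counts, and a new element can only sit directly on top of one column, so it is the code of
  one more step.\<close>

lemma ex_element_word:
  assumes "distinct xs" "\<And>k. k \<le> length xs \<Longrightarrow> set (take k xs) \<in> order_ideals (two_times n)"
  shows "\<exists>w. element_word w = xs"
  using assms
proof (induction xs rule: rev_induct)
  case Nil
  then show ?case by (metis element_word_Nil)
next
  case (snoc x xs)
  have "set (take k xs) \<in> order_ideals (two_times n)" if "k \<le> length xs" for k
    using snoc.prems(2)[of k] that by simp
  then obtain w where w: "element_word w = xs"
    using snoc.IH snoc.prems(1) by auto
  let ?a = "count_list w V" and ?b = "count_list w H"
  have I: "insert x (two_columns ?a ?b) \<in> order_ideals (two_times n)"
    using snoc.prems(2)[of "Suc (length xs)"] set_element_word[of w] w by simp
  have new: "x \<notin> two_columns ?a ?b"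
    using snoc.prems(1) set_element_word[of w] w by simp
  obtain r j where x: "x = (r, j)" by force
  have r: "r = 1 \<or> r = 2" and j: "1 \<le> j" "j \<le> n"
    using I x by (auto simp: order_ideals_def two_times_def)
  have down: "(r, i) = x \<or> (r, i) \<in> two_columns ?a ?b" if "1 \<le> i" "i \<le> j" for i
  proof -
    have "x \<in> insert x (two_columns ?a ?b)" "(r, i) \<in> two_times n" "(r, i) \<le> x"
      using r j that x by (auto simp: two_times_def)
    then show ?thesis using I unfolding order_ideals_def by blast
  qed
  from r show ?case
  proof
    assume r: "r = 1"
    with new x j have "?a < j" by (auto simp: two_columns_def)
    \<comment> \<open>For larger \<open>j\<close> the element \<open>(1, Suc ?a)\<close> would lie
      below \<open>x\<close> and be missing from the ideal.\<close>
    then have "j = Suc ?a" using down[of "Suc ?a"] r x by (auto simp: two_columns_def)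
    then have "element_word (w @ [V]) = xs @ [x]"
      using w r x by (simp add: element_word_snoc)
    then show ?case by blast
  next
    assume r: "r = 2"
    with new x j have "?b < j" by (auto simp: two_columns_def)
    then have "j = Suc ?b" using down[of "Suc ?b"] r x by (auto simp: two_columns_def)
    then have "element_word (w @ [H]) = xs @ [x]"
      using w r x by (simp add: element_word_snoc)
    then show ?case by blast
  qed
qed

lemma linear_extensions_two_times: "linear_extensions (two_times n) = element_word ` dyck_paths n"
proof -
  have "\<exists>w. element_word w = xs" if "xs \<in> linear_extensions (two_times n)" for xs
    using that ex_element_word by (auto simp: linear_extensions_def)
  then show ?thesis using element_word_linear_extension_iff by blast
qed

section \<open>Transfer of descents and of the count to Dyck paths\<close>

lemma occurs_before_map:
  assumes "inj f"
  shows "occurs_before (map f xs) (f a) (f b) \<longleftrightarrow> occurs_before xs a b"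
proof -
  have "map f xs ! p = f a \<and> map f xs ! q = f b \<longleftrightarrow> xs ! p = a \<and> xs ! q = b"
    if "p < q" "q < length xs" for p q
    using that by (simp add: inj_eq[OF assms])
  then show ?thesis unfolding occurs_before_def length_map by blast
qed

lemma descents_element_word: "descents (element_word W) (element_word w) = descent_set W w"
proof -
  have "element_word w ! i = poset_element (coded w ! i)" if "i < length w" for i
    using that by (simp add: element_word_def)
  then have "occurs_before (element_word W) (element_word w ! i) (element_word w ! (i - 1)) \<longleftrightarrow>
      occurs_before (coded W) (coded w ! i) (coded w ! (i - 1))" if "1 \<le> i" "i < length w" for i
    using that by (simp add: element_word_def[of W] occurs_before_map[OF inj_poset_element])
  then show ?thesis by (auto simp: descents_def descent_set_def)
qed

theorem theorem2p2:
  fixes n :: nat and W :: "step list" and S :: "nat set"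
  assumes "n \<ge> 1"
    and "W \<in> dyck_paths n"
    and "S \<subseteq> {1..2 * n - 1}"
  shows "flag_h_J2n n S = int (card {w \<in> dyck_paths n. descent_set W w = S})"
proof -
  \<comment> \<open>The path \<open>W\<close>, read as a linear extension, supplies the labels that
    define descents.\<close>
  interpret natural_labelling "two_times n" "element_word W"
    using assms(2) by unfold_locales (simp add: element_word_linear_extension_iff)
  have "card (two_times n) = 2 * n"
    by (simp add: two_times_def card_cartesian_product)
  moreover have "S \<subseteq> {..2 * n}" using assms(3) by fastforce
  ultimately have "flag_h_J2n n S =
      int (card {v \<in> linear_extensions (two_times n). descents (element_word W) v = S})"
    unfolding flag_h_J2n_def by (intro flag_h_order_ideals) simp
  also have "{v \<in> linear_extensions (two_times n). descents (element_word W) v = S} =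
      element_word ` {w \<in> dyck_paths n. descent_set W w = S}"
    by (auto simp: linear_extensions_two_times descents_element_word)
  also have "card \<dots> = card {w \<in> dyck_paths n. descent_set W w = S}"
    by (intro card_image inj_on_subset[OF inj_element_word]) simp
  finally show ?thesis .
qed

end
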